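(* Let $k$ be a field equipped with the identity conjugation, let $D_1,D_2,D_3\in k$, and define $k_0=k$ and $k_i=k_{i-1}\times_{D_i}k_{i-1}$ for $i=1,2,3$. Then an element $a\in k_i$ satisfies $n(a)=1$ if and only if there is a nonzero $b\in k_i$ with $\overline{b}a=b$, in each of the following cases: (a) $i=1$ and $D_1$ is not a square in $k$; (b) $i\in\{1,2,3\}$, $k$ is an ordered field and $D_1$, $D_2$ and $D_3$ are negative.
   Context: Let $k$ be a field. A $k$-algebra $K$ (not assumed commutative, associative or distributive) is a left $k$-vector space equipped with a multiplication and a multiplicative identity $1$ such that: $k$ is a subset of the center of $K$, and the additive and multiplicative structure on $k$ is the restriction of that on $K$; and $a(bc)=(ab)c$ for $a,b,c\in K$ whenever at least one of $a,b,c$ belongs to $k$. A conjugation on $K$ is a self-inverse $k$-linear map $\overline{\phantom{a}}:K\to K$ restricting to the identity on $k$. The norm is $n(a)=\overline{a}a$. Given a $k$-algebra $K$ with conjugation and $D\in k$, the Cayley-Dickson double $K\times_D K$ is the $k$-vector space $K\times K$ with conjugation $\overline{(a,b)}=(\overline{a},-b)$ and multiplication $(a,b)(c,d)=(ac+Dd\overline{b},\ \overline{a}d+cb)$ for $a,b,c,d\in K$. It is a $k$-algebra with identity $(1,0)$; $K$ (and hence $k$) is regarded as contained in it via $a\mapsto(a,0)$. $k$ is ordered if it carries a total order $\le$ such that $a\le b$ implies $a+c\le b+c$, and $0\le a$, $0\le b$ imply $0\le ab$. An element is negative if it is $\le 0$ and nonzero. *)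

theory Defs
  imports Main "HOL-Library.Product_Plus"
begin

text \<open>
  The doubling parameters are not determined by the type, so the operations live in a record.
  Only the additive group comes from the type: on \<open>'a \<times> 'a\<close> it is the
  componentwise one. The scalar field is embedded by \<open>c \<mapsto> scal K c (unity K)\<close>.
\<close>

record ('k, 'a) conj_algebra =
  scal :: "'k \<Rightarrow> 'a \<Rightarrow> 'a"
  mul :: "'a \<Rightarrow> 'a \<Rightarrow> 'a"
  unity :: 'a
  conjug :: "'a \<Rightarrow> 'a"

definition ground_algebra :: "('k::field, 'k) conj_algebra" where
  "ground_algebra = \<lparr>scal = (*), mul = (*), unity = 1, conjug = id\<rparr>"

definition cd_double ::
  "'k \<Rightarrow> ('k::field, 'a::ab_group_add) conj_algebra \<Rightarrow> ('k, 'a \<times> 'a) conj_algebra" where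
  "cd_double D K =
    \<lparr>scal = (\<lambda>r (a, b). (scal K r a, scal K r b)),
     mul = (\<lambda>(a, b) (c, d).
       (mul K a c + scal K D (mul K d (conjug K b)), mul K (conjug K a) d + mul K c b)),
     unity = (unity K, 0),
     conjug = (\<lambda>(a, b). (conjug K a, - b))\<rparr>"

definition cd_norm :: "('k, 'a) conj_algebra \<Rightarrow> 'a \<Rightarrow> 'a" where
  "cd_norm K a = mul K (conjug K a) a"

definition k1 :: "'k \<Rightarrow> ('k::field, 'k \<times> 'k) conj_algebra" where
  "k1 D1 = cd_double D1 ground_algebra"

definition k2 :: "'k \<Rightarrow> 'k \<Rightarrow> ('k::field, ('k \<times> 'k) \<times> ('k \<times> 'k)) conj_algebra" where
  "k2 D1 D2 = cd_double D2 (k1 D1)"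

definition k3 :: "'k \<Rightarrow> 'k \<Rightarrow> 'k \<Rightarrow>
    ('k::field, (('k \<times> 'k) \<times> ('k \<times> 'k)) \<times> (('k \<times> 'k) \<times> ('k \<times> 'k))) conj_algebra" where
  "k3 D1 D2 D3 = cd_double D3 (k2 D1 D2)"

end

theory Submission
  imports Defs
begin

text \<open>
  In each of the algebras \<open>cd_norm K a\<close> is a scalar \<open>q a\<close>, where \<open>q\<close> is a multiplicative
  quadratic form which under the given hypotheses vanishes only at \<open>0\<close>. Applying \<open>q\<close> to
  \<open>conjug b \<cdot> a = b\<close> and cancelling \<open>q b\<close> gives \<open>q a = 1\<close>. Conversely, if \<open>q a = 1\<close> then
  \<open>b = a + 1\<close> is a solution, unless \<open>a = -1\<close>, when any skew element is one.
\<close>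

lemma norm_eq_unity_iff:
  fixes K :: "('k::field, 'a::ab_group_add) conj_algebra" and q :: "'a \<Rightarrow> 'k"
  assumes norm: "\<And>a. cd_norm K a = unity K \<longleftrightarrow> q a = 1"
    and q_mul: "\<And>a b. q (mul K a b) = q a * q b"
    and q_conjug: "\<And>a. q (conjug K a) = q a"
    and anisotropic: "\<And>a. q a = 0 \<Longrightarrow> a = 0"
    and conjug_plus_unity: "\<And>a. mul K (conjug K (a + unity K)) a = cd_norm K a + a"
    and skew: "e \<noteq> 0" "mul K (conjug K e) (- unity K) = e"
  shows "cd_norm K a = unity K \<longleftrightarrow> (\<exists>b. b \<noteq> 0 \<and> mul K (conjug K b) a = b)"
proof
  assume a: "cd_norm K a = unity K"
  show "\<exists>b. b \<noteq> 0 \<and> mul K (conjug K b) a = b"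
  proof (cases "a + unity K = 0")
    case True
    then have "a = - unity K" by (simp add: eq_neg_iff_add_eq_0)
    with skew show ?thesis by blast
  next
    case False
    moreover have "mul K (conjug K (a + unity K)) a = a + unity K"
      by (simp add: conjug_plus_unity a add.commute)
    ultimately show ?thesis by blast
  qed
next
  assume "\<exists>b. b \<noteq> 0 \<and> mul K (conjug K b) a = b"
  then obtain b where "b \<noteq> 0" and b: "mul K (conjug K b) a = b" by blast
  have "q b * q a = q b"
    using arg_cong[OF b, of q] by (simp add: q_mul q_conjug)
  moreover have "q b \<noteq> 0" using anisotropic \<open>b \<noteq> 0\<close> by blast
  ultimately show "cd_norm K a = unity K" by (simp add: norm)
qed

text \<open>The norm with its value read as a scalar. Doubling with parameter \<open>D\<close> turns
  a norm \<open>n\<close> into \<open>n(a) - D * n(b)\<close>, which is the recursion followed by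
  the two forms below.\<close>

definition form1 :: "'k::field \<Rightarrow> 'k \<times> 'k \<Rightarrow> 'k" where
  "form1 D1 = (\<lambda>(a, b). a\<^sup>2 - D1 * b\<^sup>2)"

definition form2 :: "'k::field \<Rightarrow> 'k \<Rightarrow> ('k \<times> 'k) \<times> ('k \<times> 'k) \<Rightarrow> 'k" where
  "form2 D1 D2 = (\<lambda>(a, b). form1 D1 a - D2 * form1 D1 b)"

definition form3 :: "'k::field \<Rightarrow> 'k \<Rightarrow> 'k \<Rightarrow>
    (('k \<times> 'k) \<times> ('k \<times> 'k)) \<times> (('k \<times> 'k) \<times> ('k \<times> 'k)) \<Rightarrow> 'k" where
  "form3 D1 D2 D3 = (\<lambda>(a, b). form2 D1 D2 a - D3 * form2 D1 D2 b)"

lemmas k1_unfold = k1_def cd_double_def ground_algebra_def cd_norm_def form1_def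
lemmas k2_unfold = k2_def form2_def k1_unfold
lemmas k3_unfold = k3_def form3_def k2_unfold

text \<open>Brahmagupta's two-square identity weighted by \<open>D1\<close>; in coordinates it is a
  polynomial identity.\<close>

lemma form1_mul: "form1 D1 (mul (k1 D1) a b) = form1 D1 a * form1 D1 b"
  by (induct a; induct b; (simp only: split_paired_all)?)
    (simp add: k1_unfold algebra_simps power2_eq_square)

lemma k1_iff:
  assumes anisotropic: "\<And>a. form1 D1 a = 0 \<Longrightarrow> a = 0"
  shows "cd_norm (k1 D1) a = unity (k1 D1) \<longleftrightarrow>
    (\<exists>b. b \<noteq> 0 \<and> mul (k1 D1) (conjug (k1 D1) b) a = b)"
\<comment> \<open>The adjoined element \<open>(0, 1)\<close> is negated by conjugation, so it is the
  skew witness for \<open>a = -1\<close>, in characteristic 2 as well.\<close>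
proof (rule norm_eq_unity_iff[where q = "form1 D1" and e = "(0, 1)"])
qed (use anisotropic in \<open>auto simp: form1_mul k1_unfold zero_prod_def algebra_simps power2_eq_square\<close>)

text \<open>Euler's four-square identity, weighted by the parameters.\<close>

lemma form2_mul: "form2 D1 D2 (mul (k2 D1 D2) a b) = form2 D1 D2 a * form2 D1 D2 b"
  by (induct a; induct b; (simp only: split_paired_all)?)
    (simp add: k2_unfold algebra_simps power2_eq_square)

lemma k2_iff:
  assumes anisotropic: "\<And>a. form2 D1 D2 a = 0 \<Longrightarrow> a = 0"
  shows "cd_norm (k2 D1 D2) a = unity (k2 D1 D2) \<longleftrightarrow>
    (\<exists>b. b \<noteq> 0 \<and> mul (k2 D1 D2) (conjug (k2 D1 D2) b) a = b)"
\<comment> \<open>The skew witness is again \<open>0\<close> paired with the unity of the previous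
  algebra.\<close>
proof (rule norm_eq_unity_iff[where q = "form2 D1 D2" and e = "(0, (1, 0))"])
qed (use anisotropic in \<open>auto simp: form2_mul k2_unfold zero_prod_def algebra_simps power2_eq_square\<close>)

text \<open>Degen's eight-square identity, weighted by the parameters. Expanding in coordinates
  avoids any appeal to associativity, which octonion-like algebras lack.\<close>

lemma form3_mul: "form3 D1 D2 D3 (mul (k3 D1 D2 D3) a b) = form3 D1 D2 D3 a * form3 D1 D2 D3 b"
  by (induct a; induct b; (simp only: split_paired_all)?)
    (simp add: k3_unfold algebra_simps power2_eq_square)

lemma k3_iff:
  assumes anisotropic: "\<And>a. form3 D1 D2 D3 a = 0 \<Longrightarrow> a = 0"
  shows "cd_norm (k3 D1 D2 D3) a = unity (k3 D1 D2 D3) \<longleftrightarrow>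
    (\<exists>b. b \<noteq> 0 \<and> mul (k3 D1 D2 D3) (conjug (k3 D1 D2 D3) b) a = b)"
proof (rule norm_eq_unity_iff[where q = "form3 D1 D2 D3" and e = "(0, ((1, 0), (0, 0)))"])
qed (use anisotropic in \<open>auto simp: form3_mul k3_unfold zero_prod_def algebra_simps power2_eq_square\<close>)

text \<open>A zero \<open>(x, y)\<close> with \<open>y\<close> nonzero would exhibit
  \<open>D1\<close> as the square of \<open>x / y\<close>.\<close>

lemma form1_anisotropic_nonsquare:
  assumes "\<nexists>c. D1 = c\<^sup>2" and "form1 D1 a = 0"
  shows "a = 0"
proof -
  obtain x y where a: "a = (x, y)" by (cases a)
  have x: "x\<^sup>2 = D1 * y\<^sup>2" using assms(2) by (simp add: a form1_def)
  have "y = 0"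
  proof (rule ccontr)
    assume "y \<noteq> 0"
    then have "D1 = (x / y)\<^sup>2" using x by (simp add: power_divide)
    with assms(1) show False by blast
  qed
  with x show ?thesis by (simp add: a zero_prod_def)
qed

text \<open>One doubling step for positivity: with \<open>s\<close> and \<open>t\<close> the form
  values of the two components, \<open>s - D * t\<close> is a sum of nonnegative terms and vanishes
  only if both do.\<close>

lemma neg_mult_nonneg_le:
  fixes D s t :: "'k::linordered_field"
  assumes "D < 0" "0 \<le> s" "0 \<le> t"
  shows "D * t \<le> s" and "s = D * t \<longleftrightarrow> s = 0 \<and> t = 0"
proof -
  have t: "D * t \<le> 0" using assms by (simp add: mult_nonpos_nonneg)
  then show "D * t \<le> s" using assms(2) by simp
  show "s = D * t \<longleftrightarrow> s = 0 \<and> t = 0"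
    using t assms(1,2) by auto
qed

text \<open>Nonnegativity accompanies the zero criterion because the next doubling needs
  both.\<close>

lemma
  fixes D1 :: "'k::linordered_field"
  assumes "D1 < 0"
  shows form1_nonneg: "0 \<le> form1 D1 a"
    and form1_eq_0_iff: "form1 D1 a = 0 \<longleftrightarrow> a = 0"
  using assms by (auto simp: form1_def neg_mult_nonneg_le zero_prod_def split: prod.splits)

lemma
  fixes D1 D2 :: "'k::linordered_field"
  assumes "D1 < 0" "D2 < 0"
  shows form2_nonneg: "0 \<le> form2 D1 D2 a"
    and form2_eq_0_iff: "form2 D1 D2 a = 0 \<longleftrightarrow> a = 0"
  using assms
  by (auto simp: form2_def neg_mult_nonneg_le form1_nonneg form1_eq_0_iff zero_prod_def
      split: prod.splits)

lemma form3_eq_0_iff: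
  fixes D1 D2 D3 :: "'k::linordered_field"
  assumes "D1 < 0" "D2 < 0" "D3 < 0"
  shows "form3 D1 D2 D3 a = 0 \<longleftrightarrow> a = 0"
  using assms
  by (auto simp: form3_def neg_mult_nonneg_le form2_nonneg form2_eq_0_iff zero_prod_def
      split: prod.splits)

theorem corollary2:
  "(\<forall>D1 :: 'f::field. (\<nexists>c. D1 = c\<^sup>2) \<longrightarrow>
      (\<forall>a. cd_norm (k1 D1) a = unity (k1 D1) \<longleftrightarrow>
        (\<exists>b. b \<noteq> 0 \<and> mul (k1 D1) (conjug (k1 D1) b) a = b)))
   \<and>
   (\<forall>D1 D2 D3 :: 'k::linordered_field. D1 < 0 \<and> D2 < 0 \<and> D3 < 0 \<longrightarrow>
      (\<forall>a. cd_norm (k1 D1) a = unity (k1 D1) \<longleftrightarrow>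
        (\<exists>b. b \<noteq> 0 \<and> mul (k1 D1) (conjug (k1 D1) b) a = b)) \<and>
      (\<forall>a. cd_norm (k2 D1 D2) a = unity (k2 D1 D2) \<longleftrightarrow>
        (\<exists>b. b \<noteq> 0 \<and> mul (k2 D1 D2) (conjug (k2 D1 D2) b) a = b)) \<and>
      (\<forall>a. cd_norm (k3 D1 D2 D3) a = unity (k3 D1 D2 D3) \<longleftrightarrow>
        (\<exists>b. b \<noteq> 0 \<and> mul (k3 D1 D2 D3) (conjug (k3 D1 D2 D3) b) a = b)))"
  \<comment> \<open>Each equivalence is reduced to anisotropy of its form, the only point where the
    hypotheses on the parameters enter.\<close>
  by (intro conjI allI impI k1_iff k2_iff k3_iff)
    (auto simp: form1_anisotropic_nonsquare form1_eq_0_iff form2_eq_0_iff form3_eq_0_iff)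

end
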